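(* Let $s$ be a transcendent defined on $[0,\infty)$, i.e. a real solution of $s''(t) = 2 s(t)^3 - t\, s(t)$ for all $t \geqslant 0$ with $s(0) = 0$ and $s'(0) \neq 0$. If $a < b$ in $[0,\infty)$ are consecutive zeros of $s$, then the open interval $(a,b)$ contains a zero of each Airy function.
   Context: All functions are real-valued functions of a real variable $t$. An Airy function is a function $g$ satisfying $g''(t) + t\, g(t) = 0$ for all $t$ in its interval of definition, and in particular for all $t \geqslant 0$. Consecutive zeros $a<b$ of $s$ are points with $s(a) = s(b) = 0$ and $s(t) \neq 0$ for all $t \in (a,b)$. *)

theory Defs
  imports "HOL-Analysis.Analysis"
begin

text \<open>
  Derivatives are taken within the domain of definition, so they are one-sided at an
  endpoint belonging to the domain. The function \<open>f'\<close> is the first derivative of \<open>f\<close> on \<open>I\<close>;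
  it is unique there whenever \<open>I\<close> is a nondegenerate interval.
\<close>

definition has_derivs_on ::
    "(real \<Rightarrow> real) \<Rightarrow> (real \<Rightarrow> real) \<Rightarrow> (real \<Rightarrow> real) \<Rightarrow> real set \<Rightarrow> bool" where
  "has_derivs_on f f' f'' I \<longleftrightarrow>
     (\<forall>t\<in>I. (f has_real_derivative f' t) (at t within I) \<and>
            (f' has_real_derivative f'' t) (at t within I))"

definition transcendent :: "(real \<Rightarrow> real) \<Rightarrow> bool" where
  "transcendent s \<longleftrightarrow>
     (\<exists>s'. has_derivs_on s s' (\<lambda>t. 2 * s t ^ 3 - t * s t) {0..} \<and> s 0 = 0 \<and> s' 0 \<noteq> 0)"

text \<open>The zero function is not excluded; \<open>I\<close> is the interval on which \<open>g\<close> is defined.\<close>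

definition airy_function_on :: "real set \<Rightarrow> (real \<Rightarrow> real) \<Rightarrow> bool" where
  "airy_function_on I g \<longleftrightarrow>
     is_interval I \<and> {0..} \<subseteq> I \<and>
     (\<exists>g' g''. has_derivs_on g g' g'' I \<and> (\<forall>t\<in>I. g'' t + t * g t = 0))"

definition consecutive_zeros :: "(real \<Rightarrow> real) \<Rightarrow> real \<Rightarrow> real \<Rightarrow> bool" where
  "consecutive_zeros s a b \<longleftrightarrow>
     a < b \<and> s a = 0 \<and> s b = 0 \<and> (\<forall>t\<in>{a<..<b}. s t \<noteq> 0)"

end

theory Submission
  imports Defs
begin

text \<open>
  The idea is Sturm comparison. Read the nonlinear equation for \<open>s\<close> as the linear equation
  \<open>s'' = (2 s\<^sup>2 - t) s\<close> whose coefficient involves the solution itself, next to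
  \<open>g'' = - t g\<close>. Between consecutive zeros of \<open>s\<close> the first coefficient is strictly larger than
  the second, so \<open>g\<close> oscillates faster than \<open>s\<close>.

  The comparison itself comes from the Wronskian \<open>W = s' g - s g'\<close>, for which
  \<open>W' = 2 s\<^sup>3 g\<close>. If \<open>g\<close> had no zero in \<open>(a, b)\<close>, both functions could be taken positive
  there after changes of sign, so that \<open>W\<close> would be strictly increasing. But \<open>s\<close> leaves \<open>0\<close>
  upwards at \<open>a\<close> and returns to \<open>0\<close> from above at \<open>b\<close>, which forces
  \<open>W a = s' a * g a \<ge> 0 \<ge> s' b * g b = W b\<close>. The changes of sign are
  harmless because both equations have been read as linear ones.
\<close>

lemma has_derivs_on_subset:
  assumes "has_derivs_on f f' f'' I" "J \<subseteq> I"
  shows "has_derivs_on f f' f'' J"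
  using assms unfolding has_derivs_on_def by (meson has_field_derivative_subset subsetD)

lemma has_derivs_on_scale:
  assumes "has_derivs_on f f' f'' I"
  shows "has_derivs_on (\<lambda>t. c * f t) (\<lambda>t. c * f' t) (\<lambda>t. c * f'' t) I"
  using assms unfolding has_derivs_on_def by (auto intro: DERIV_cmult)

lemma has_derivs_on_imp_continuous_on:
  assumes "has_derivs_on f f' f'' I"
  shows "continuous_on I f" "continuous_on I f'"
  using assms unfolding has_derivs_on_def continuous_on_eq_continuous_within
  by (blast intro: DERIV_continuous)+

lemma has_derivs_on_interior:
  assumes "has_derivs_on f f' f'' {a..b}" "a < t" "t < b"
  shows "(f has_real_derivative f' t) (at t)" "(f' has_real_derivative f'' t) (at t)"
  using assms unfolding has_derivs_on_def
  by (metis at_within_Icc_at atLeastAtMost_iff less_imp_le)+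

lemma nonzero_imp_constant_sign:
  fixes f :: "real \<Rightarrow> real"
  assumes cont: "continuous_on {a<..<b} f" and nz: "\<And>t. t \<in> {a<..<b} \<Longrightarrow> f t \<noteq> 0"
  obtains c where "\<And>t. t \<in> {a<..<b} \<Longrightarrow> c * f t > 0"
proof (cases "\<exists>x\<in>{a<..<b}. f x > 0")
  case True
  then obtain x where x: "x \<in> {a<..<b}" "f x > 0" by blast
  have "1 * f y > 0" if "y \<in> {a<..<b}" for y
  proof (rule ccontr)
    assume "\<not> 1 * f y > 0"
    then have "0 \<in> f ` {a<..<b}"
      using connectedD_interval[OF connected_continuous_image[OF cont connected_Ioo], of "f y" "f x" 0]
        x that by auto
    then show False using nz by force
  qed
  then show ?thesis by (rule that)
next
  case False
  then have "(-1) * f t > 0" if "t \<in> {a<..<b}" for t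
    using nz[OF that] that by (metis linorder_neqE_linordered_idom mult_minus1 neg_0_less_iff_less)
  then show ?thesis by (rule that)
qed

text \<open>
  The Wronskian argument. Only weak inequalities hold at the endpoints (\<open>v\<close> may vanish there),
  so the strict growth of the Wronskian in the interior has to carry the contradiction.
\<close>

lemma sturm_no_two_positive_solutions:
  fixes u v p q :: "real \<Rightarrow> real"
  assumes "a < b"
    and u: "has_derivs_on u u' (\<lambda>t. p t * u t) {a..b}"
    and v: "has_derivs_on v v' (\<lambda>t. q t * v t) {a..b}"
    and ends: "u a = 0" "u b = 0"
    and less: "\<And>t. t \<in> {a<..<b} \<Longrightarrow> q t < p t"
    and upos: "\<And>t. t \<in> {a<..<b} \<Longrightarrow> u t > 0"
    and vpos: "\<And>t. t \<in> {a<..<b} \<Longrightarrow> v t > 0"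
  shows False
proof -
  define W where "W t = u' t * v t - u t * v' t" for t
  note cont = has_derivs_on_imp_continuous_on[OF u] has_derivs_on_imp_continuous_on[OF v]
  have vge: "v t \<ge> 0" if "t \<in> {a..b}" for t
    using continuous_ge_on_closure[of "{a<..<b}" v t 0] that vpos cont \<open>a < b\<close>
    by (auto simp: less_imp_le)
  have "u' a \<ge> 0"
  proof (rule ccontr)
    assume "\<not> u' a \<ge> 0"
    moreover have "(u has_real_derivative u' a) (at a within {a..b})"
      using u \<open>a < b\<close> by (simp add: has_derivs_on_def)
    ultimately obtain d where d: "d > 0"
      "\<And>h. 0 < h \<Longrightarrow> a + h \<in> {a..b} \<Longrightarrow> h < d \<Longrightarrow> u (a + h) < u a"
      using has_real_derivative_neg_dec_right[of u "u' a" a "{a..b}"] by auto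
    define h where "h = min d (b - a) / 2"
    have "0 < h" "h < d" "a + h < b" using d(1) \<open>a < b\<close> by (auto simp: h_def min_def field_simps)
    then show False using d(2)[of h] upos[of "a + h"] ends by auto
  qed
  moreover have "u' b \<le> 0"
  proof (rule ccontr)
    assume "\<not> u' b \<le> 0"
    moreover have "(u has_real_derivative u' b) (at b within {a..b})"
      using u \<open>a < b\<close> by (simp add: has_derivs_on_def)
    ultimately obtain d where d: "d > 0"
      "\<And>h. 0 < h \<Longrightarrow> b - h \<in> {a..b} \<Longrightarrow> h < d \<Longrightarrow> u (b - h) < u b"
      using has_real_derivative_pos_inc_left[of u "u' b" b "{a..b}"] by auto
    define h where "h = min d (b - a) / 2"
    have "0 < h" "h < d" "a < b - h" using d(1) \<open>a < b\<close> by (auto simp: h_def min_def field_simps)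
    then show False using d(2)[of h] upos[of "b - h"] ends by auto
  qed
  ultimately have "u' b * v b \<le> 0" "0 \<le> u' a * v a"
    using vge[of a] vge[of b] \<open>a < b\<close> by (simp_all add: mult_nonpos_nonneg)
  then have "W b \<le> W a"
    using ends by (simp add: W_def)
  moreover have "W a < W b"
  proof (rule DERIV_pos_imp_increasing_open[OF \<open>a < b\<close>])
    show "continuous_on {a..b} W"
      unfolding W_def by (intro continuous_intros cont)
    fix t assume t: "a < t" "t < b"
    have "(W has_real_derivative (p t - q t) * (u t * v t)) (at t)"
      unfolding W_def
      by (rule derivative_eq_intros has_derivs_on_interior[OF u t] has_derivs_on_interior[OF v t] refl)+
         (simp add: algebra_simps)
    moreover have "(p t - q t) * (u t * v t) > 0"
      using less[of t] upos[of t] vpos[of t] t by simp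
    ultimately show "\<exists>y. (W has_real_derivative y) (at t) \<and> y > 0" by blast
  qed
  ultimately show False by simp
qed

theorem sturm_comparison:
  fixes u v p q :: "real \<Rightarrow> real"
  assumes zeros: "consecutive_zeros u a b"
    and u: "has_derivs_on u u' (\<lambda>t. p t * u t) {a..b}"
    and v: "has_derivs_on v v' (\<lambda>t. q t * v t) {a..b}"
    and less: "\<And>t. t \<in> {a<..<b} \<Longrightarrow> q t < p t"
  shows "\<exists>t\<in>{a<..<b}. v t = 0"
proof (rule ccontr)
  assume no_zero: "\<not> ?thesis"
  have sub: "{a<..<b} \<subseteq> {a..b}" by auto
  obtain c where c: "\<And>t. t \<in> {a<..<b} \<Longrightarrow> c * u t > 0"
    using nonzero_imp_constant_sign[of a b u] zeros
      continuous_on_subset[OF has_derivs_on_imp_continuous_on(1)[OF u] sub]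
    by (auto simp: consecutive_zeros_def)
  obtain d where d: "\<And>t. t \<in> {a<..<b} \<Longrightarrow> d * v t > 0"
    using nonzero_imp_constant_sign[of a b v] no_zero
      continuous_on_subset[OF has_derivs_on_imp_continuous_on(1)[OF v] sub]
    by blast
  have cu: "has_derivs_on (\<lambda>t. c * u t) (\<lambda>t. c * u' t) (\<lambda>t. p t * (c * u t)) {a..b}"
    using has_derivs_on_scale[OF u, of c] by (simp add: mult.left_commute)
  have dv: "has_derivs_on (\<lambda>t. d * v t) (\<lambda>t. d * v' t) (\<lambda>t. q t * (d * v t)) {a..b}"
    using has_derivs_on_scale[OF v, of d] by (simp add: mult.left_commute)
  show False
    by (rule sturm_no_two_positive_solutions[OF _ cu dv])
       (use zeros less c d in \<open>auto simp: consecutive_zeros_def\<close>)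
qed

theorem theorem7:
  fixes s :: "real \<Rightarrow> real" and a b :: real
  assumes "transcendent s"
    and "a \<in> {0..}" and "b \<in> {0..}"
    and "consecutive_zeros s a b"
  shows "\<forall>I g. airy_function_on I g \<longrightarrow> (\<exists>t\<in>{a<..<b}. g t = 0)"
proof (intro allI impI)
  fix I g assume airy: "airy_function_on I g"
  have sub: "{a..b} \<subseteq> {0..}" using assms(2) by auto
  obtain s' where "has_derivs_on s s' (\<lambda>t. 2 * s t ^ 3 - t * s t) {0..}"
    using assms(1) by (auto simp: transcendent_def)
  moreover have "(\<lambda>t. 2 * s t ^ 3 - t * s t) = (\<lambda>t. (2 * s t ^ 2 - t) * s t)"
    by (simp add: fun_eq_iff algebra_simps power2_eq_square power3_eq_cube)
  ultimately have s: "has_derivs_on s s' (\<lambda>t. (2 * s t ^ 2 - t) * s t) {a..b}"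
    using has_derivs_on_subset[OF _ sub] by metis
  obtain g' g'' where g0: "has_derivs_on g g' g'' I" and ode: "\<forall>t\<in>I. g'' t + t * g t = 0"
    and I: "{0..} \<subseteq> I"
    using airy by (auto simp: airy_function_on_def)
  have "g'' t = (- t) * g t" if "t \<in> {a..b}" for t
    using ode that sub I by (metis add_eq_0_iff2 minus_mult_left subsetD)
  moreover have "has_derivs_on g g' g'' {a..b}"
    using has_derivs_on_subset[OF g0] sub I by blast
  ultimately have g: "has_derivs_on g g' (\<lambda>t. (- t) * g t) {a..b}"
    by (simp add: has_derivs_on_def)
  show "\<exists>t\<in>{a<..<b}. g t = 0"
    by (rule sturm_comparison[OF assms(4) s g])
       (use assms(4) in \<open>auto simp: consecutive_zeros_def\<close>)
qed

end
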